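(* For all integers $k\ge 2$ and all positive integers $n,m$, $$\mathrm{HB2}_k(n,m)\le mn-\sqrt{\frac{2k}{k-1}\,(2nm-n-m)}.$$
   Context: A two-dimensional partial word of size $n$ by $m$ over an alphabet $A$ is a map $w:\{0,\dots,n-1\}\times\{0,\dots,m-1\}\to A\cup\{\diamondsuit\}$, where $\diamondsuit\notin A$ is a hole; its domain $\mathrm{D}(w)$ is the set of positions $p$ with $w(p)\in A$. An $(n,m)$-ruler is a subset $R\subseteq\{0,\dots,n-1\}\times\{0,\dots,m-1\}$ such that every $(x,y)\in\mathbb{Z}^2$ with $|x|\le n-1$, $|y|\le m-1$ equals $r_1-r_2$ for some $r_1,r_2\in R$. The two-dimensional partial word $w$ is unbordered if $\mathrm{D}(w)$ is an $(n,m)$-ruler and for every nonzero vector $v$ with $|v_1|\le n-1$, $|v_2|\le m-1$ there exist $r_1,r_2\in\mathrm{D}(w)$ with $r_1-r_2=v$ and $w(r_1)\ne w(r_2)$. $\mathrm{HB2}_k(n,m)$ denotes the maximum number of holes an $n$ by $m$ unbordered two-dimensional partial word over an alphabet of size $k$ can have. *)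

theory Defs
  imports Complex_Main "HOL-Library.FuncSet" "HOL-Library.Product_Plus"
begin

definition grid :: "nat \<Rightarrow> nat \<Rightarrow> (int \<times> int) set" where
  "grid n m = {0..<int n} \<times> {0..<int m}"

text \<open>\<open>None\<close> is the hole; \<open>w\<close> is a function on the grid, so its values elsewhere are irrelevant
  (fixed to \<open>undefined\<close> by the extensional function space).\<close>

definition partial_words2 :: "'a set \<Rightarrow> nat \<Rightarrow> nat \<Rightarrow> (int \<times> int \<Rightarrow> 'a option) set" where
  "partial_words2 A n m = grid n m \<rightarrow>\<^sub>E insert None (Some ` A)"

definition word_dom :: "nat \<Rightarrow> nat \<Rightarrow> (int \<times> int \<Rightarrow> 'a option) \<Rightarrow> (int \<times> int) set" where
  "word_dom n m w = {p \<in> grid n m. w p \<noteq> None}"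

definition holes :: "nat \<Rightarrow> nat \<Rightarrow> (int \<times> int \<Rightarrow> 'a option) \<Rightarrow> (int \<times> int) set" where
  "holes n m w = {p \<in> grid n m. w p = None}"

definition ruler2 :: "nat \<Rightarrow> nat \<Rightarrow> (int \<times> int) set \<Rightarrow> bool" where
  "ruler2 n m R \<longleftrightarrow> R \<subseteq> grid n m \<and>
     (\<forall>x y. \<bar>x\<bar> \<le> int n - 1 \<and> \<bar>y\<bar> \<le> int m - 1 \<longrightarrow> (\<exists>r\<^sub>1\<in>R. \<exists>r\<^sub>2\<in>R. (x, y) = r\<^sub>1 - r\<^sub>2))"

definition unbordered2 :: "nat \<Rightarrow> nat \<Rightarrow> (int \<times> int \<Rightarrow> 'a option) \<Rightarrow> bool" where
  "unbordered2 n m w \<longleftrightarrow> ruler2 n m (word_dom n m w) \<and>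
     (\<forall>v. v \<noteq> 0 \<and> \<bar>fst v\<bar> \<le> int n - 1 \<and> \<bar>snd v\<bar> \<le> int m - 1 \<longrightarrow>
        (\<exists>r\<^sub>1\<in>word_dom n m w. \<exists>r\<^sub>2\<in>word_dom n m w. r\<^sub>1 - r\<^sub>2 = v \<and> w r\<^sub>1 \<noteq> w r\<^sub>2))"

definition hole_counts :: "'a set \<Rightarrow> nat \<Rightarrow> nat \<Rightarrow> nat set" where
  "hole_counts A n m = (\<lambda>w. card (holes n m w)) ` {w \<in> partial_words2 A n m. unbordered2 n m w}"

text \<open>The alphabet of size \<open>k\<close> is taken to be \<open>{..<k}\<close>; see \<open>hole_counts_alphabet\<close> for the
  independence of this choice. Unbordered words need not exist (there is none of size 2 by 2 over
  a binary alphabet); the maximum over the empty set is then 0 by convention.\<close>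

definition HB2 :: "nat \<Rightarrow> nat \<Rightarrow> nat \<Rightarrow> nat" where
  "HB2 k n m = (if hole_counts {..<k} n m = {} then 0 else Max (hole_counts {..<k} n m))"

lemma finite_grid: "finite (grid n m)"
  by (simp add: grid_def)

lemma finite_hole_counts: "finite (hole_counts A n m)"
proof (rule finite_subset)
  show "hole_counts A n m \<subseteq> {..card (grid n m)}"
    by (auto simp: hole_counts_def holes_def intro!: card_mono finite_grid)
qed simp

lemma hole_counts_mono_inj:
  assumes inj: "inj_on f A" and sub: "f ` A \<subseteq> B"
  shows "hole_counts A n m \<subseteq> hole_counts B n m"
proof
  fix c assume "c \<in> hole_counts A n m"
  then obtain w where w: "w \<in> partial_words2 A n m" "unbordered2 n m w" "c = card (holes n m w)"
    by (auto simp: hole_counts_def)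
  define u where "u = restrict (\<lambda>p. map_option f (w p)) (grid n m)"
  have wp: "w p \<in> insert None (Some ` A)" if "p \<in> grid n m" for p
    using PiE_mem[OF w(1)[unfolded partial_words2_def] that] .
  have u: "u \<in> partial_words2 B n m"
    unfolding partial_words2_def
  proof (rule PiE_I)
    fix p assume p: "p \<in> grid n m"
    then have "u p = map_option f (w p)" by (simp add: u_def)
    with wp[OF p] sub show "u p \<in> insert None (Some ` B)" by auto
  qed (simp add: u_def)
  have D: "word_dom n m u = word_dom n m w" and H: "holes n m u = holes n m w"
    by (auto simp: word_dom_def holes_def u_def)
  have ne: "u p \<noteq> u q" if "p \<in> word_dom n m w" "q \<in> word_dom n m w" "w p \<noteq> w q" for p q
    using that wp[of p] wp[of q] inj by (auto simp: word_dom_def u_def inj_on_eq_iff)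
  have "unbordered2 n m u"
    unfolding unbordered2_def D
  proof (intro conjI allI impI)
    show "ruler2 n m (word_dom n m w)" using w(2) by (simp add: unbordered2_def)
    fix v :: "int \<times> int"
    assume "v \<noteq> 0 \<and> \<bar>fst v\<bar> \<le> int n - 1 \<and> \<bar>snd v\<bar> \<le> int m - 1"
    then obtain p q where "p \<in> word_dom n m w" "q \<in> word_dom n m w" "p - q = v" "w p \<noteq> w q"
      using w(2) unfolding unbordered2_def by blast
    then show "\<exists>r\<^sub>1\<in>word_dom n m w. \<exists>r\<^sub>2\<in>word_dom n m w. r\<^sub>1 - r\<^sub>2 = v \<and> u r\<^sub>1 \<noteq> u r\<^sub>2"
      using ne by blast
  qed
  with u H w(3) show "c \<in> hole_counts B n m"
    unfolding hole_counts_def by (intro image_eqI[where x = u]) simp_all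
qed

lemma hole_counts_alphabet:
  assumes "finite A"
  shows "hole_counts A n m = hole_counts {..<card A} n m"
proof -
  obtain f where f: "bij_betw f A {..<card A}"
    using ex_bij_betw_finite_nat[OF assms] by (auto simp: atLeast0LessThan)
  have g: "bij_betw (inv_into A f) {..<card A} A"
    by (rule bij_betw_inv_into[OF f])
  show ?thesis
  proof (rule equalityI)
    show "hole_counts A n m \<subseteq> hole_counts {..<card A} n m"
      using f by (intro hole_counts_mono_inj[of f]) (auto simp: bij_betw_def)
    show "hole_counts {..<card A} n m \<subseteq> hole_counts A n m"
      using g by (intro hole_counts_mono_inj[of "inv_into A f"]) (auto simp: bij_betw_def)
  qed
qed

end

theory Submission
  imports Defs "HOL-Analysis.Convex"
begin

text \<open>An unbordered word realises each of the \<open>2 (2 n m - n - m)\<close> nonzero vectors as the difference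
  of an ordered pair of domain positions carrying distinct letters. A domain of size \<open>d\<close> coloured
  with \<open>k\<close> letters has, by Cauchy--Schwarz on the colour classes, at most \<open>d\<^sup>2 (1 - 1/k)\<close> such pairs,
  which bounds \<open>d\<close> from below. If there are no unbordered words, the right-hand side
  must be shown to be nonnegative, an elementary inequality in \<open>n\<close> and \<open>m\<close>.\<close>

text \<open>The ordered pairs of equal colour form the disjoint squares
  \<open>F i \<times> F i\<close> of the colour classes. The class sizes sum to
  \<open>card D\<close>, so by Cauchy-Schwarz there are at least \<open>(card D)^2 / card C\<close>
  such pairs; the differently coloured ones are the rest of \<open>D \<times> D\<close>.\<close>

lemma card_differently_coloured_pairs_le:
  fixes c :: "'b \<Rightarrow> 'c"
  assumes fin: "finite D" "finite C" and ne: "C \<noteq> {}" and c: "c ` D \<subseteq> C"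
  shows "real (card {(p, q) \<in> D \<times> D. c p \<noteq> c q}) \<le>
    (real (card C) - 1) / real (card C) * (real (card D))\<^sup>2"
proof -
  define F where "F i = {p \<in> D. c p = i}" for i
  have kpos: "0 < real (card C)" using ne fin by (simp add: card_gt_0_iff)
  have "card D = card (\<Union>i\<in>C. F i)" using c by (intro arg_cong[where f = card]) (auto simp: F_def)
  also have "\<dots> = (\<Sum>i\<in>C. card (F i))"
    using fin by (intro card_UN_disjoint) (auto simp: F_def)
  finally have D: "real (card D) = (\<Sum>i\<in>C. real (card (F i)))" by simp
  have "card {(p, q) \<in> D \<times> D. c p = c q} = card (\<Union>i\<in>C. F i \<times> F i)"
    using c by (intro arg_cong[where f = card]) (auto simp: F_def)
  also have "\<dots> = (\<Sum>i\<in>C. card (F i \<times> F i))"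
    using fin by (intro card_UN_disjoint) (auto simp: F_def)
  finally have same: "real (card {(p, q) \<in> D \<times> D. c p = c q}) = (\<Sum>i\<in>C. (real (card (F i)))\<^sup>2)"
    by (simp add: card_cartesian_product power2_eq_square)
  have "card (D \<times> D) = card ({(p, q) \<in> D \<times> D. c p = c q} \<union> {(p, q) \<in> D \<times> D. c p \<noteq> c q})"
    by (intro arg_cong[where f = card]) auto
  also have "\<dots> = card {(p, q) \<in> D \<times> D. c p = c q} + card {(p, q) \<in> D \<times> D. c p \<noteq> c q}"
    using fin by (intro card_Un_disjoint) (auto intro: finite_subset[of _ "D \<times> D"])
  finally have "(real (card D))\<^sup>2 =
      real (card {(p, q) \<in> D \<times> D. c p = c q}) + real (card {(p, q) \<in> D \<times> D. c p \<noteq> c q})"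
    by (simp only: card_cartesian_product power2_eq_square flip: of_nat_add of_nat_mult)
  moreover have "(real (card D))\<^sup>2 \<le> real (card C) * (\<Sum>i\<in>C. (real (card (F i)))\<^sup>2)"
    unfolding D using sum_squared_le_sum_of_squares[of "\<lambda>i. real (card (F i))" C] by (simp add: mult.commute)
  ultimately show ?thesis using kpos unfolding same by (simp add: field_simps)
qed

lemma card_nonzero_vectors:
  assumes "0 < n" "0 < m"
  shows "real (card {v :: int \<times> int. v \<noteq> 0 \<and> \<bar>fst v\<bar> \<le> int n - 1 \<and> \<bar>snd v\<bar> \<le> int m - 1}) =
    2 * (2 * real n * real m - real n - real m)"
proof -
  let ?B = "{1 - int n..int n - 1} \<times> {1 - int m..int m - 1}"
  have "{v :: int \<times> int. v \<noteq> 0 \<and> \<bar>fst v\<bar> \<le> int n - 1 \<and> \<bar>snd v\<bar> \<le> int m - 1} = ?B - {0}"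
    by (auto simp: abs_le_iff)
  moreover have "card (?B - {0}) = card ?B - 1"
    using assms by (intro card_Diff_singleton) (auto simp: zero_prod_def)
  moreover have "card ?B = (2 * n - 1) * (2 * m - 1)"
  proof -
    have "nat (int n - 1 - (1 - int n) + 1) = 2 * n - 1" "nat (int m - 1 - (1 - int m) + 1) = 2 * m - 1"
      using assms by linarith+
    then show ?thesis by (simp only: card_cartesian_product card_atLeastAtMost_int)
  qed
  \<comment> \<open>Makes the truncated subtraction \<open>card ?B - 1\<close> agree with real
    subtraction.\<close>
  moreover have "1 \<le> (2 * n - 1) * (2 * m - 1)" using assms by (simp add: Suc_le_eq)
  ultimately show ?thesis using assms by (simp add: algebra_simps)
qed

lemma unbordered2_card_word_dom_ge:
  assumes w: "w \<in> partial_words2 A n m" "unbordered2 n m w"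
    and A: "finite A" "2 \<le> card A" and pos: "0 < n" "0 < m"
  shows "sqrt (2 * real (card A) / (real (card A) - 1) * (2 * real n * real m - real n - real m)) \<le>
    real (card (word_dom n m w))"
proof -
  let ?D = "word_dom n m w"
  let ?P = "{(p, q) \<in> ?D \<times> ?D. w p \<noteq> w q}"
  let ?V = "{v :: int \<times> int. v \<noteq> 0 \<and> \<bar>fst v\<bar> \<le> int n - 1 \<and> \<bar>snd v\<bar> \<le> int m - 1}"
  have finD: "finite ?D" using finite_grid by (simp add: word_dom_def)
  \<comment> \<open>Each vector of \<open>?V\<close> is the difference of some pair in
    \<open>?P\<close>, hence \<open>card ?V \<le> card ?P\<close>.\<close>
  have "?V \<subseteq> (\<lambda>(p, q). p - q) ` ?P"
  proof
    fix v assume "v \<in> ?V"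
    then obtain p q where "p \<in> ?D" "q \<in> ?D" "p - q = v" "w p \<noteq> w q"
      using w(2) unfolding unbordered2_def by blast
    then show "v \<in> (\<lambda>(p, q). p - q) ` ?P" by (intro image_eqI[where x = "(p, q)"]) auto
  qed
  moreover have "finite ?P" using finD by (auto intro: finite_subset[of _ "?D \<times> ?D"])
  ultimately have "card ?V \<le> card ?P" by (rule surj_card_le[rotated])
  then have "2 * (2 * real n * real m - real n - real m) \<le> real (card ?P)"
    using card_nonzero_vectors[OF pos] by linarith
  \<comment> \<open>The colouring is \<open>w\<close> itself; on its domain it takes values in the
    image of \<open>A\<close> under the injective \<open>Some\<close>, so there are
    \<open>card A\<close> colours.\<close>
  also have "\<dots> \<le> (real (card (Some ` A)) - 1) / real (card (Some ` A)) * (real (card ?D))\<^sup>2"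
  proof (rule card_differently_coloured_pairs_le)
    show "w ` ?D \<subseteq> Some ` A" using w(1) by (fastforce simp: word_dom_def partial_words2_def PiE_def Pi_def)
  qed (use A finD in auto)
  finally have "2 * (2 * real n * real m - real n - real m) \<le>
      (real (card A) - 1) / real (card A) * (real (card ?D))\<^sup>2"
    by (simp add: card_image)
  \<comment> \<open>The factor \<open>(k - 1) / k\<close> with \<open>k = card A\<close> is
    inverted; it is positive because \<open>2 \<le> card A\<close>.\<close>
  then have "real (card A) / (real (card A) - 1) * (2 * (2 * real n * real m - real n - real m)) \<le>
      real (card A) / (real (card A) - 1) *
        ((real (card A) - 1) / real (card A) * (real (card ?D))\<^sup>2)"
    by (rule mult_left_mono) (use A in simp)
  also have "\<dots> = (real (card ?D))\<^sup>2" using A by auto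
  finally have "2 * real (card A) / (real (card A) - 1) * (2 * real n * real m - real n - real m) \<le>
      (real (card ?D))\<^sup>2"
    by (simp only: times_divide_eq_left times_divide_eq_right mult_ac)
  then show ?thesis by (intro real_le_lsqrt) auto
qed

lemma card_holes: "real (card (holes n m w)) = real m * real n - real (card (word_dom n m w))"
proof -
  have "card (grid n m) = card (holes n m w \<union> word_dom n m w)"
    by (intro arg_cong[where f = card]) (auto simp: holes_def word_dom_def)
  also have "\<dots> = card (holes n m w) + card (word_dom n m w)"
    using finite_grid by (intro card_Un_disjoint) (auto simp: holes_def word_dom_def)
  finally have "n * m = card (holes n m w) + card (word_dom n m w)"
    by (simp add: grid_def card_cartesian_product)
  then have "real n * real m = real (card (holes n m w)) + real (card (word_dom n m w))"
    by (metis of_nat_add of_nat_mult)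
  then show ?thesis by (simp add: algebra_simps)
qed

text \<open>Here 4 is the largest value of \<open>2 * k / (k - 1)\<close>, attained at
  \<open>k = 2\<close>. The inequality is tight at sizes 1 by 2, 2 by 1 and 2 by 2, so small sides
  are treated separately.\<close>

lemma four_mult_le_square_area:
  fixes n m :: nat
  assumes "0 < n" "0 < m"
  shows "4 * (2 * real n * real m - real n - real m) \<le> (real m * real n)\<^sup>2"
proof -
  consider "n = 1" | "n = 2" | "m = 1" | "m = 2" | "3 \<le> n" "3 \<le> m" using assms by linarith
  then show ?thesis
  proof cases
    case 1
    \<comment> \<open>The two sides differ by exactly \<open>(m - 2)^2\<close>.\<close>
    then show ?thesis using zero_le_power2[of "real m - 2"] by (simp add: power2_eq_square algebra_simps)
  next
    case 2
    \<comment> \<open>The two sides differ by four times this product, which would be negative for a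
      real \<open>m\<close> strictly between 1 and 2; integrality excludes that.\<close>
    have "0 \<le> (real m - 1) * (real m - 2)"
      using assms by (cases "m = 1") auto
    then show ?thesis using 2 by (simp add: power2_eq_square algebra_simps)
  next
    case 3
    then show ?thesis using zero_le_power2[of "real n - 2"] by (simp add: power2_eq_square algebra_simps)
  next
    case 4
    have "0 \<le> (real n - 1) * (real n - 2)"
      using assms by (cases "n = 1") auto
    then show ?thesis using 4 by (simp add: power2_eq_square algebra_simps)
  next
    case 5
    \<comment> \<open>An area of at least 8 suffices, since the left-hand side is below
      \<open>8 * n * m\<close>.\<close>
    then have "3 * 3 \<le> real m * real n" by (intro mult_mono) auto
    then have "8 * (real m * real n) \<le> (real m * real n)\<^sup>2"
      unfolding power2_eq_square by (intro mult_right_mono) auto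
    then show ?thesis by (simp add: algebra_simps)
  qed
qed

lemma sqrt_bound_le_area:
  fixes k n m :: nat
  assumes "2 \<le> k" and "0 < n" and "0 < m"
  shows "sqrt (2 * real k / (real k - 1) * (2 * real n * real m - real n - real m)) \<le>
    real m * real n"
proof -
  \<comment> \<open>The factor \<open>2nm - n - m\<close> must be nonnegative before its coefficient
    can be enlarged to 4.\<close>
  have "real n * 1 \<le> real n * real m" "1 * real m \<le> real n * real m"
    using assms by (auto intro!: mult_mono)
  then have "0 \<le> 2 * real n * real m - real n - real m" by linarith
  moreover have "2 * real k / (real k - 1) \<le> 4" using assms by (simp add: field_simps)
  ultimately have "2 * real k / (real k - 1) * (2 * real n * real m - real n - real m) \<le>
      4 * (2 * real n * real m - real n - real m)"
    by (intro mult_right_mono)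
  also have "\<dots> \<le> (real m * real n)\<^sup>2" using assms by (intro four_mult_le_square_area)
  finally show ?thesis by (intro real_le_lsqrt) auto
qed

theorem theorem13:
  fixes k n m :: nat
  assumes "2 \<le> k" and "0 < n" and "0 < m"
  shows "real (HB2 k n m) \<le>
    real m * real n - sqrt (2 * real k / (real k - 1) * (2 * real n * real m - real n - real m))"
proof (cases "hole_counts {..<k} n m = {}")
  \<comment> \<open>Without unbordered words \<open>HB2\<close> has the default value 0, so the
    claim is that the root is at most the area.\<close>
  case True
  then show ?thesis using sqrt_bound_le_area[OF assms] by (simp add: HB2_def)
next
  case False
  \<comment> \<open>The maximum of a finite nonempty set is attained, which yields an actual word to
    bound.\<close>
  then have "HB2 k n m \<in> hole_counts {..<k} n m"
    using Max_in[OF finite_hole_counts] by (simp add: HB2_def)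
  then obtain w where w: "w \<in> partial_words2 {..<k} n m" "unbordered2 n m w"
      "HB2 k n m = card (holes n m w)"
    by (auto simp: hole_counts_def)
  show ?thesis
    using unbordered2_card_word_dom_ge[OF w(1,2)] assms by (simp add: w(3) card_holes)
qed

end
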